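(* Let $\mathcal{H}$ be a real Hilbert space, $C\subset\mathcal{H}$ a nonempty, closed and convex set, and $f:\mathcal{H}\to\mathbb{R}$ a convex and Gateaux differentiable function such that the solution set $S_*$ of the problem $\min\{f(x) : x\in C\}$ is nonempty. Suppose that $\nabla f$ is uniformly continuous on bounded sets. Then any sequence $(x^k)_{k\in\mathbb{N}}$ generated by Algorithm A1 (with any $x^0\in C$, any $\theta,\delta\in(0,1)$ and any stepsizes $(\beta_k)_{k\in\mathbb N}\subset[\check\beta,\hat\beta]$ with $0<\check\beta\le\hat\beta<\infty$) converges weakly to a point of $S_*$.
   Context: $\nabla f(x)\in\mathcal{H}$ denotes the Gateaux derivative of $f$ at $x$ (the directional derivative satisfies $f'(x;d)=\langle\nabla f(x),d\rangle$ for all $d\in\mathcal{H}$). $P_C$ is the metric projection onto $C$. $S_*=\{x\in C: f(x)\le f(y)\ \forall y\in C\}$. Here $\mathbb{N}=\{0,1,2,\dots\}$. "$\nabla f$ is uniformly continuous on bounded sets" means that the restriction of $\nabla f$ to each bounded subset of $\mathcal{H}$ is uniformly continuous (norm to norm). Algorithm A1. Fix $\theta,\delta\in(0,1)$ and a sequence $(\beta_k)_{k\in\mathbb N}\subset[\check\beta,\hat\beta]$ with $0<\check\beta\le\hat\beta<\infty$. Take $x^0\in C$. For $k=0,1,2,\dots$: given $x^k$, put $z^k=x^k-\beta_k\nabla f(x^k)$. If $x^k=P_C(z^k)$, stop. Otherwise set $\alpha_k=\theta^{j(k)}$, where $$j(k)=\min\{j\in\mathbb{N} : f(x^{k,j})\le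 f(x^k)-\delta\theta^j\langle\nabla f(x^k),x^k-P_C(z^k)\rangle\},\qquad x^{k,j}=\theta^jP_C(z^k)+(1-\theta^j)x^k,$$ and set $x^{k+1}=\alpha_kP_C(z^k)+(1-\alpha_k)x^k$. "A sequence $(x^k)_{k\in\mathbb{N}}$ generated by Algorithm A1" means an infinite sequence, i.e. the algorithm does not stop. *)

theory Defs
  imports "HOL-Analysis.Analysis"
begin

definition has_gateaux_gradient :: "('a::real_inner \<Rightarrow> real) \<Rightarrow> 'a \<Rightarrow> 'a \<Rightarrow> bool"
  where "has_gateaux_gradient f g x \<longleftrightarrow>
    (\<forall>d. ((\<lambda>t. (f (x + t *\<^sub>R d) - f x) / t) \<longlongrightarrow> inner g d) (at_right 0))"

definition gateaux_differentiable_at :: "('a::real_inner \<Rightarrow> real) \<Rightarrow> 'a \<Rightarrow> bool"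
  where "gateaux_differentiable_at f x \<longleftrightarrow> (\<exists>g. has_gateaux_gradient f g x)"

definition grad :: "('a::real_inner \<Rightarrow> real) \<Rightarrow> 'a \<Rightarrow> 'a"
  where "grad f x = (THE g. has_gateaux_gradient f g x)"

text \<open>The library's \<open>closest_point\<close> is restricted to Heine-Borel spaces, which rules out
  infinite-dimensional Hilbert spaces. The description below is proper when \<open>C\<close> is a nonempty,
  closed and convex subset of a Hilbert space.\<close>

definition metric_proj :: "'a::metric_space set \<Rightarrow> 'a \<Rightarrow> 'a"
  where "metric_proj C z = (THE p. p \<in> C \<and> (\<forall>y\<in>C. dist z p \<le> dist z y))"

definition solution_set :: "('a \<Rightarrow> real) \<Rightarrow> 'a set \<Rightarrow> 'a set"
  where "solution_set f C = {x \<in> C. \<forall>y\<in>C. f x \<le> f y}"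

definition weakly_converges :: "(nat \<Rightarrow> 'a::real_normed_vector) \<Rightarrow> 'a \<Rightarrow> bool"
  where "weakly_converges x l \<longleftrightarrow>
    (\<forall>\<phi> :: 'a \<Rightarrow> real. bounded_linear \<phi> \<longrightarrow> (\<lambda>k. \<phi> (x k)) \<longlonglongrightarrow> \<phi> l)"

definition proj_grad_point :: "('a::real_inner \<Rightarrow> real) \<Rightarrow> 'a set \<Rightarrow> real \<Rightarrow> 'a \<Rightarrow> 'a"
  where "proj_grad_point f C b x = metric_proj C (x - b *\<^sub>R grad f x)"

definition search_point ::
    "('a::real_inner \<Rightarrow> real) \<Rightarrow> 'a set \<Rightarrow> real \<Rightarrow> real \<Rightarrow> 'a \<Rightarrow> nat \<Rightarrow> 'a"
  where "search_point f C \<theta> b x j =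
    \<theta> ^ j *\<^sub>R proj_grad_point f C b x + (1 - \<theta> ^ j) *\<^sub>R x"

definition search_index ::
    "('a::real_inner \<Rightarrow> real) \<Rightarrow> 'a set \<Rightarrow> real \<Rightarrow> real \<Rightarrow> real \<Rightarrow> 'a \<Rightarrow> nat"
  where "search_index f C \<theta> \<delta> b x =
    (LEAST j. f (search_point f C \<theta> b x j)
                \<le> f x - \<delta> * \<theta> ^ j * inner (grad f x) (x - proj_grad_point f C b x))"

text \<open>The second conjunct says that the stopping test never succeeds, so that the algorithm
  produces an infinite sequence.\<close>

definition generated_by_A1 ::
    "('a::real_inner \<Rightarrow> real) \<Rightarrow> 'a set \<Rightarrow> real \<Rightarrow> real \<Rightarrow> (nat \<Rightarrow> real) \<Rightarrow> (nat \<Rightarrow> 'a) \<Rightarrow> bool"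
  where "generated_by_A1 f C \<theta> \<delta> \<beta> x \<longleftrightarrow>
    x 0 \<in> C \<and>
    (\<forall>k. x k \<noteq> proj_grad_point f C (\<beta> k) (x k)) \<and>
    (\<forall>k. let \<alpha> = \<theta> ^ search_index f C \<theta> \<delta> (\<beta> k) (x k)
         in x (Suc k) = \<alpha> *\<^sub>R proj_grad_point f C (\<beta> k) (x k) + (1 - \<alpha>) *\<^sub>R x k)"

end

theory Submission
  imports Defs
begin

text \<open>
  Each step increases the squared distance to a solution \<open>z\<close> by at most a constant times the decrease
  of \<open>f\<close>, so the distances to solutions converge. If \<open>f (x k)\<close> stayed away from the minimum, the
  step sizes would tend to \<open>0\<close>; the last rejected trial point then approaches \<open>x k\<close>, and uniform
  continuity of the gradient forces the slopes, hence \<open>x k - P\<^sub>C (z k)\<close> and finally the gap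
  \<open>f (x k) - f z\<close>, to vanish.

  Weak compactness is avoided by asymptotic centers, i.e. minimizers of
  \<open>z \<mapsto> limsup (norm (y k - z))\<^sup>2\<close>. The center of a bounded sequence exists in every Hilbert space
  and lies in each closed convex set that eventually contains the sequence. Hence the centers of
  \<open>x\<close> and of all its subsequences are solutions; convergence of the distances makes them
  coincide. A subsequence separated from the center by a functional lies in a closed half-space,
  which would also contain its own center.
\<close>

section \<open>Minimizers of strongly convex functions and metric projection\<close>

text \<open>The parallelogram law, arranged as the midpoint inequality that
  \<open>strongly_convex_minimizer\<close> asks for.\<close>

lemma midpoint_norm_sq:
  fixes w a b :: "'a::real_inner"
  shows "(norm (w - (1/2) *\<^sub>R (a + b)))\<^sup>2
    = ((norm (w - a))\<^sup>2 + (norm (w - b))\<^sup>2) / 2 - (norm (a - b))\<^sup>2 / 4"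
  by (simp add: power2_norm_eq_inner inner_diff inner_add inner_commute field_simps)

lemma midpoint_in_convex:
  assumes "convex D" "a \<in> D" "b \<in> D"
  shows "(1/2) *\<^sub>R (a + b) \<in> D"
  using convexD[OF assms, of "1/2" "1/2"] by (simp add: scaleR_add_right)

text \<open>The midpoint inequality makes minimizing sequences Cauchy, so completeness takes the
  place of compactness. Used between the minimizer and another point, it also yields the quadratic
  growth.\<close>

lemma strongly_convex_minimizer:
  fixes \<phi> :: "'a::{real_inner, complete_space} \<Rightarrow> real"
  assumes "closed D" "convex D" "D \<noteq> {}"
    and lower: "\<And>z. z \<in> D \<Longrightarrow> m \<le> \<phi> z"
    and mid: "\<And>a b. a \<in> D \<Longrightarrow> b \<in> D \<Longrightarrow>
      \<phi> ((1/2) *\<^sub>R (a + b)) \<le> (\<phi> a + \<phi> b) / 2 - (norm (a - b))\<^sup>2 / 4"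
    and lsc: "\<And>s l c. (s :: nat \<Rightarrow> 'a) \<longlonglongrightarrow> l \<Longrightarrow> (\<lambda>n. \<phi> (s n)) \<longlonglongrightarrow> c \<Longrightarrow> \<phi> l \<le> c"
  obtains u where "u \<in> D" "\<And>z. z \<in> D \<Longrightarrow> \<phi> u + (norm (z - u))\<^sup>2 / 2 \<le> \<phi> z"
proof -
  define I where "I = Inf (\<phi> ` D)"
  have bdd: "bdd_below (\<phi> ` D)" using lower by (auto intro: bdd_belowI[of _ m])
  have I_le: "I \<le> \<phi> z" if "z \<in> D" for z
    unfolding I_def using bdd that by (simp add: cInf_lower)
  have "\<exists>z\<in>D. \<phi> z < I + inverse (Suc n)" for n
  proof -
    have "Inf (\<phi> ` D) < I + inverse (Suc n)" by (simp add: I_def)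
    then show ?thesis using cInf_lessD[of "\<phi> ` D"] assms(3) by blast
  qed
  then obtain s where s: "\<And>n. s n \<in> D" "\<And>n. \<phi> (s n) < I + inverse (Suc n)" by metis
  have lim: "(\<lambda>n. \<phi> (s n)) \<longlonglongrightarrow> I"
  proof (rule tendsto_sandwich)
    show "(\<lambda>n. I) \<longlonglongrightarrow> I" by simp
    show "(\<lambda>n. I + inverse (Suc n)) \<longlonglongrightarrow> I"
      using tendsto_add[OF tendsto_const LIMSEQ_inverse_real_of_nat, of I] by simp
    show "\<forall>\<^sub>F n in sequentially. \<phi> (s n) \<le> I + inverse (Suc n)"
      using s(2) by (intro always_eventually allI less_imp_le)
  qed (use s I_le in \<open>auto intro!: always_eventually\<close>)
  \<comment> \<open>The midpoint stays in \<open>D\<close>, so its value is at least the infimum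
    \<open>I\<close>.\<close>
  have close: "(norm (a - b))\<^sup>2 / 4 \<le> (\<phi> a + \<phi> b) / 2 - I" if "a \<in> D" "b \<in> D" for a b
    using mid[OF that] I_le[OF midpoint_in_convex[OF assms(2) that]] by linarith
  have "Cauchy s"
  proof (rule metric_CauchyI)
    fix e :: real assume "e > 0"
    then obtain N where N: "\<And>n. n \<ge> N \<Longrightarrow> \<phi> (s n) < I + e\<^sup>2 / 4"
      using order_tendstoD(2)[OF lim, of "I + e\<^sup>2 / 4"] by (auto simp: eventually_sequentially)
    have "dist (s m) (s n) < e" if "m \<ge> N" "n \<ge> N" for m n
    proof -
      have "(norm (s m - s n))\<^sup>2 < e\<^sup>2"
        using close[OF s(1) s(1), of m n] N[OF that(1)] N[OF that(2)] by argo
      then show ?thesis using \<open>e > 0\<close> by (simp add: dist_norm power2_less_imp_less)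
    qed
    then show "\<exists>N. \<forall>m\<ge>N. \<forall>n\<ge>N. dist (s m) (s n) < e" by blast
  qed
  then obtain u where u: "s \<longlonglongrightarrow> u" using Cauchy_convergent convergent_def by blast
  have uD: "u \<in> D" using assms(1) s(1) u closed_sequentially by blast
  have "\<phi> u \<le> I" by (rule lsc[OF u lim])
  then have "\<phi> u + (norm (z - u))\<^sup>2 / 2 \<le> \<phi> z" if "z \<in> D" for z
    using close[OF that uD] by argo
  then show thesis using that uD by blast
qed

text \<open>Quadratic growth of the squared distance makes the nearest point unique, so the
  description in \<open>metric_proj\<close> is proper.\<close>

lemma metric_proj_char:
  fixes C :: "'a::{real_inner, complete_space} set"
  assumes "closed C" "convex C" "C \<noteq> {}"
  shows metric_proj_in: "metric_proj C z \<in> C"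
    and metric_proj_dot: "y \<in> C \<Longrightarrow> inner (z - metric_proj C z) (y - metric_proj C z) \<le> 0"
proof -
  define \<phi> where "\<phi> w = (norm (z - w))\<^sup>2" for w
  obtain p where p: "p \<in> C" and p_min: "\<And>y. y \<in> C \<Longrightarrow> \<phi> p + (norm (y - p))\<^sup>2 / 2 \<le> \<phi> y"
  proof (rule strongly_convex_minimizer[OF assms, of 0 \<phi>])
    show "\<phi> l \<le> c" if "s \<longlonglongrightarrow> l" "(\<lambda>n. \<phi> (s n)) \<longlonglongrightarrow> c" for s :: "nat \<Rightarrow> 'a" and l c
    proof -
      have "(\<lambda>n. \<phi> (s n)) \<longlonglongrightarrow> \<phi> l" unfolding \<phi>_def by (intro tendsto_intros that)
      then show ?thesis using that(2) LIMSEQ_unique by blast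
    qed
  qed (auto simp: \<phi>_def midpoint_norm_sq)
  have near: "dist z p \<le> dist z y" if "y \<in> C" for y
    using p_min[OF that] power2_le_imp_le[of "norm (z - p)" "norm (z - y)"]
    unfolding \<phi>_def dist_norm by (smt (verit) divide_nonneg_nonneg norm_ge_zero zero_le_power2)
  have eq: "metric_proj C z = p"
    unfolding metric_proj_def
  proof (rule the_equality)
    fix q assume q: "q \<in> C \<and> (\<forall>y\<in>C. dist z q \<le> dist z y)"
    then have "dist z q \<le> dist z p" using p by blast
    then have "\<phi> q \<le> \<phi> p" by (simp add: \<phi>_def dist_norm power_mono)
    then have "(norm (q - p))\<^sup>2 \<le> 0" using p_min[of q] q by linarith
    then show "q = p" by simp
  qed (use p near in blast)
  show "metric_proj C z \<in> C" using p eq by simp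
  show "inner (z - metric_proj C z) (y - metric_proj C z) \<le> 0" if "y \<in> C"
    unfolding eq using any_closest_point_dot[OF assms(2,1) p that] near by blast
qed

section \<open>Gradients of convex functions\<close>

lemma has_gateaux_gradient_unique:
  assumes "has_gateaux_gradient f g x" "has_gateaux_gradient f g' x"
  shows "g = g'"
proof -
  have "inner g d = inner g' d" for d
    using assms tendsto_unique[OF trivial_limit_at_right_real] unfolding has_gateaux_gradient_def by blast
  then show ?thesis by (metis inner_eq_zero_iff inner_diff_left right_minus_eq)
qed

lemma has_gateaux_gradient_grad:
  assumes "gateaux_differentiable_at f x"
  shows "has_gateaux_gradient f (grad f x) x"
proof -
  obtain g where g: "has_gateaux_gradient f g x"
    using assms by (auto simp: gateaux_differentiable_at_def)
  then have "grad f x = g"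
    unfolding grad_def using has_gateaux_gradient_unique by blast
  then show ?thesis using g by simp
qed

text \<open>By convexity the difference quotients towards \<open>y\<close> stay below
  \<open>f y - f x\<close> for small \<open>t > 0\<close>; the bound passes to the limit.\<close>

lemma convex_gradient_ineq:
  assumes "convex_on UNIV f" "has_gateaux_gradient f g x"
  shows "f x + inner g (y - x) \<le> f y"
proof -
  have "((\<lambda>t. (f (x + t *\<^sub>R (y - x)) - f x) / t) \<longlongrightarrow> inner g (y - x)) (at_right 0)"
    using assms(2) by (simp add: has_gateaux_gradient_def)
  moreover have "\<forall>\<^sub>F t in at_right 0. (f (x + t *\<^sub>R (y - x)) - f x) / t \<le> f y - f x"
    using eventually_at_right_less[of 0] eventually_at_right_real[of 0 1, OF zero_less_one]
  proof eventually_elim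
    case (elim t)
    have "f ((1 - t) *\<^sub>R x + t *\<^sub>R y) \<le> (1 - t) * f x + t * f y"
      using convex_onD[OF assms(1), of t x y] elim by simp
    moreover have "(1 - t) *\<^sub>R x + t *\<^sub>R y = x + t *\<^sub>R (y - x)" by (simp add: algebra_simps)
    ultimately show ?case using elim by (simp add: field_simps)
  qed
  ultimately have "inner g (y - x) \<le> f y - f x"
    by (rule tendsto_upperbound) simp
  then show ?thesis by simp
qed

text \<open>Balls need not be compact. Instead, walk from 0 to \<open>w\<close> in \<open>N\<close>
  equal steps shorter than \<open>\<eta>\<close>, each changing \<open>g\<close> by less than 1;
  \<open>N\<close> does not depend on \<open>w\<close>.\<close>

lemma bounded_uniformly_continuous_ball_image:
  fixes g :: "'a::real_normed_vector \<Rightarrow> 'b::real_normed_vector"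
  assumes "uniformly_continuous_on (cball 0 M) g"
  shows "bounded (g ` cball 0 M)"
proof -
  obtain \<eta> where "\<eta> > 0" and \<eta>: "\<And>a b. \<lbrakk>a \<in> cball 0 M; b \<in> cball 0 M; dist b a < \<eta>\<rbrakk> \<Longrightarrow> dist (g b) (g a) < 1"
    using assms unfolding uniformly_continuous_on_def by (metis zero_less_one)
  obtain N :: nat where N: "M / \<eta> < real N" using reals_Archimedean2 by blast
  have "norm (g w) \<le> norm (g 0) + real N" if w: "w \<in> cball 0 M" for w
  proof -
    have M: "norm w \<le> M" using w by simp
    then have "0 \<le> M" using norm_ge_zero order_trans by blast
    with N \<open>\<eta> > 0\<close> have N0: "0 < real N" by (meson divide_nonneg_pos order_le_less_trans)
    have pt: "(real i / real N) *\<^sub>R w \<in> cball 0 M" if "i \<le> N" for i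
    proof -
      have "real i / real N \<le> 1" using that N0 by simp
      then have "real i / real N * norm w \<le> 1 * norm w" by (intro mult_right_mono) auto
      then show ?thesis using M by simp
    qed
    have "i \<le> N \<Longrightarrow> norm (g ((real i / real N) *\<^sub>R w)) \<le> norm (g 0) + real i" for i
    proof (induction i)
      case (Suc i)
      have "(real (Suc i) / real N) *\<^sub>R w - (real i / real N) *\<^sub>R w = (1 / real N) *\<^sub>R w"
        by (simp add: scaleR_diff_left[symmetric] diff_divide_distrib[symmetric])
      then have "dist ((real (Suc i) / real N) *\<^sub>R w) ((real i / real N) *\<^sub>R w) = norm w / real N"
        by (simp add: dist_norm)
      also have "\<dots> \<le> M / real N" using M N0 by (simp add: divide_right_mono)
      also have "\<dots> < \<eta>" using N N0 \<open>\<eta> > 0\<close> by (simp add: field_simps)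
      finally have "dist (g ((real (Suc i) / real N) *\<^sub>R w)) (g ((real i / real N) *\<^sub>R w)) < 1"
        using \<eta>[OF pt pt] Suc.prems by (meson Suc_leD)
      then have "norm (g ((real (Suc i) / real N) *\<^sub>R w)) < norm (g ((real i / real N) *\<^sub>R w)) + 1"
        unfolding dist_norm by (smt (verit) norm_triangle_ineq2)
      then show ?case using Suc by simp
    qed simp
    from this[of N] show ?thesis using N0 by simp
  qed
  then show ?thesis by (auto intro!: boundedI)
qed

section \<open>Asymptotic centers\<close>

text \<open>For bounded \<open>y\<close> this is the upper limit of \<open>(norm (y k - z))\<^sup>2\<close>; its minimizer over \<open>z\<close>
  is the asymptotic center of \<open>y\<close>.\<close>

definition asym_radius :: "(nat \<Rightarrow> 'a::real_normed_vector) \<Rightarrow> 'a \<Rightarrow> real"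
  where "asym_radius y z = Inf {c. \<forall>\<^sub>F k in sequentially. (norm (y k - z))\<^sup>2 \<le> c}"

lemma
  assumes "bounded (range y)"
  shows asym_radius_le: "\<forall>\<^sub>F k in sequentially. (norm (y k - z))\<^sup>2 \<le> c \<Longrightarrow> asym_radius y z \<le> c"
    and asym_radius_nonneg: "0 \<le> asym_radius y z"
    and asym_radius_eventually:
      "0 < e \<Longrightarrow> \<forall>\<^sub>F k in sequentially. (norm (y k - z))\<^sup>2 \<le> asym_radius y z + e"
proof -
  let ?S = "{c. \<forall>\<^sub>F k in sequentially. (norm (y k - z))\<^sup>2 \<le> c}"
  have low: "0 \<le> c" if c: "c \<in> ?S" for c
  proof -
    have "\<forall>\<^sub>F k in sequentially. (norm (y k - z))\<^sup>2 \<le> c" using c by simp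
    then obtain k where "(norm (y k - z))\<^sup>2 \<le> c" by (auto simp: eventually_sequentially)
    then show ?thesis by (smt (verit) zero_le_power2)
  qed
  obtain B where B: "\<And>k. norm (y k) \<le> B" using assms by (auto simp: bounded_iff)
  have "(norm (y k - z))\<^sup>2 \<le> (B + norm z)\<^sup>2" for k
    using B[of k] norm_triangle_ineq4[of "y k" z] by (intro power_mono) auto
  then have ne: "?S \<noteq> {}" by (auto intro!: exI[of _ "(B + norm z)\<^sup>2"])
  have bdd: "bdd_below ?S" using low by (rule bdd_belowI)
  show "asym_radius y z \<le> c" if "\<forall>\<^sub>F k in sequentially. (norm (y k - z))\<^sup>2 \<le> c"
    unfolding asym_radius_def using that bdd by (simp add: cInf_lower)
  show "0 \<le> asym_radius y z" unfolding asym_radius_def by (rule cInf_greatest[OF ne low])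
  show "\<forall>\<^sub>F k in sequentially. (norm (y k - z))\<^sup>2 \<le> asym_radius y z + e" if "0 < e"
  proof -
    have "Inf ?S < asym_radius y z + e" using that by (simp add: asym_radius_def)
    then obtain c where c: "c \<in> ?S" "c < asym_radius y z + e" using cInf_lessD[OF ne] by blast
    from c(1) have "\<forall>\<^sub>F k in sequentially. (norm (y k - z))\<^sup>2 \<le> c" by simp
    then show ?thesis by eventually_elim (use c(2) in simp)
  qed
qed

text \<open>Shows later that a subsequence keeps the radius about every point to which the distances
  converge.\<close>

lemma asym_radius_eq_lim:
  assumes "bounded (range y)" "(\<lambda>k. (norm (y k - z))\<^sup>2) \<longlonglongrightarrow> l"
  shows "asym_radius y z = l"
proof (rule antisym)
  show "asym_radius y z \<le> l"
  proof (rule field_le_epsilon)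
    fix e :: real assume "e > 0"
    then have "\<forall>\<^sub>F k in sequentially. (norm (y k - z))\<^sup>2 < l + e"
      using order_tendstoD(2)[OF assms(2)] by simp
    then show "asym_radius y z \<le> l + e"
      by (intro asym_radius_le assms(1)) (auto elim: eventually_mono)
  qed
  show "l \<le> asym_radius y z"
  proof (rule field_le_epsilon)
    fix e :: real assume "e > 0"
    show "l \<le> asym_radius y z + e"
      by (rule tendsto_upperbound[OF assms(2) asym_radius_eventually]) (use assms(1) \<open>e > 0\<close> in auto)
  qed
qed

text \<open>The upper limit of squared distances inherits their midpoint inequality, which gives the
  center. Were the center outside \<open>D\<close>, its projection onto \<open>D\<close> would have
  a smaller radius.\<close>

lemma asymptotic_center:
  fixes y :: "nat \<Rightarrow> 'a::{real_inner, complete_space}"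
  assumes bdd: "bounded (range y)"
  obtains u where "\<And>z. asym_radius y u + (norm (z - u))\<^sup>2 / 2 \<le> asym_radius y z"
    and "\<And>D. \<lbrakk>closed D; convex D; \<forall>\<^sub>F k in sequentially. y k \<in> D\<rbrakk> \<Longrightarrow> u \<in> D"
proof -
  obtain B where B: "\<And>k. norm (y k) \<le> B" using bdd by (auto simp: bounded_iff)
  obtain u where u: "\<And>z. asym_radius y u + (norm (z - u))\<^sup>2 / 2 \<le> asym_radius y z"
  proof (rule strongly_convex_minimizer[of UNIV 0 "asym_radius y"])
    fix a b :: 'a
    show "asym_radius y ((1/2) *\<^sub>R (a + b))
      \<le> (asym_radius y a + asym_radius y b) / 2 - (norm (a - b))\<^sup>2 / 4"
    proof (rule field_le_epsilon)
      fix e :: real assume "e > 0"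
      show "asym_radius y ((1/2) *\<^sub>R (a + b))
        \<le> (asym_radius y a + asym_radius y b) / 2 - (norm (a - b))\<^sup>2 / 4 + e"
      proof (rule asym_radius_le[OF bdd])
        show "\<forall>\<^sub>F k in sequentially. (norm (y k - (1/2) *\<^sub>R (a + b)))\<^sup>2
          \<le> (asym_radius y a + asym_radius y b) / 2 - (norm (a - b))\<^sup>2 / 4 + e"
          using asym_radius_eventually[OF bdd \<open>e > 0\<close>, of a] asym_radius_eventually[OF bdd \<open>e > 0\<close>, of b]
          by eventually_elim (unfold midpoint_norm_sq, argo)
      qed
    qed
  next
    fix s :: "nat \<Rightarrow> 'a" and l c
    assume s: "s \<longlonglongrightarrow> l" "(\<lambda>n. asym_radius y (s n)) \<longlonglongrightarrow> c"
    \<comment> \<open>Bound on the difference of the squared distances from \<open>y k\<close> to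
      \<open>l\<close> and to \<open>s n\<close>: uniform in \<open>k\<close> and vanishing as
      \<open>s n\<close> tends to \<open>l\<close>.\<close>
    define r where "r n = norm (s n - l) * (norm (s n) + norm l + 2 * B)" for n
    have "asym_radius y l \<le> asym_radius y (s n) + r n" for n
    proof (rule field_le_epsilon)
      fix e :: real assume "e > 0"
      have step: "(norm (y k - l))\<^sup>2 \<le> (norm (y k - s n))\<^sup>2 + r n" for k
      proof -
        have "(norm (y k - l))\<^sup>2 - (norm (y k - s n))\<^sup>2 = inner (s n - l) (2 *\<^sub>R y k - s n - l)"
          by (simp add: power2_norm_eq_inner inner_simps inner_commute)
        also have "\<dots> \<le> norm (s n - l) * norm (2 *\<^sub>R y k - s n - l)"
          by (rule norm_cauchy_schwarz)
        also have "\<dots> \<le> r n" unfolding r_def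
        proof (rule mult_left_mono)
          show "norm (2 *\<^sub>R y k - s n - l) \<le> norm (s n) + norm l + 2 * B"
            using norm_triangle_ineq4[of "2 *\<^sub>R y k - s n" l] norm_triangle_ineq4[of "2 *\<^sub>R y k" "s n"] B[of k]
            by simp
        qed simp
        finally show ?thesis by simp
      qed
      show "asym_radius y l \<le> asym_radius y (s n) + r n + e"
        by (rule asym_radius_le[OF bdd], rule eventually_mono[OF asym_radius_eventually[OF bdd \<open>e > 0\<close>, of "s n"]])
          (use step in \<open>smt (verit)\<close>)
    qed
    moreover have "(\<lambda>n. asym_radius y (s n) + r n) \<longlonglongrightarrow> c + norm (l - l) * (norm l + norm l + 2 * B)"
      unfolding r_def by (intro tendsto_intros s)
    ultimately show "asym_radius y l \<le> c"
      by (intro LIMSEQ_le_const[of "\<lambda>n. asym_radius y (s n) + r n"]) auto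
  qed (auto simp: asym_radius_nonneg[OF bdd])
  moreover have "u \<in> D" if D: "closed D" "convex D" "\<forall>\<^sub>F k in sequentially. y k \<in> D" for D
  proof -
    have "D \<noteq> {}" using D(3) by (auto simp: eventually_sequentially)
    note proj = metric_proj_char[OF D(1,2) this]
    define p where "p = metric_proj D u"
    \<comment> \<open>The angle at \<open>p\<close> between \<open>u\<close> and a late
      \<open>y k\<close> is not acute, so passing from \<open>u\<close> to \<open>p\<close> lowers
      the squared distance by at least \<open>(norm (u - p))\<^sup>2\<close>.\<close>
    have "asym_radius y p \<le> asym_radius y u - (norm (u - p))\<^sup>2"
    proof (rule field_le_epsilon)
      fix e :: real assume "e > 0"
      show "asym_radius y p \<le> asym_radius y u - (norm (u - p))\<^sup>2 + e"
      proof (rule asym_radius_le[OF bdd])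
        show "\<forall>\<^sub>F k in sequentially. (norm (y k - p))\<^sup>2 \<le> asym_radius y u - (norm (u - p))\<^sup>2 + e"
          using D(3) asym_radius_eventually[OF bdd \<open>e > 0\<close>, of u]
        proof eventually_elim
          case (elim k)
          have "inner (u - p) (y k - p) \<le> 0" using proj(2)[OF elim(1)] by (simp add: p_def)
          moreover have "(norm (y k - u))\<^sup>2 = (norm (y k - p))\<^sup>2 + (norm (u - p))\<^sup>2 - 2 * inner (u - p) (y k - p)"
            by (simp add: power2_norm_eq_inner inner_simps inner_commute)
          ultimately show ?case using elim(2) by simp
        qed
      qed
    qed
    then have "(norm (u - p))\<^sup>2 \<le> 0" using u[of p] by (smt (verit) divide_nonneg_nonneg zero_le_power2)
    then show ?thesis using proj(1)[of u] by (simp add: p_def)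
  qed
  ultimately show thesis using that by blast
qed

text \<open>A form of Opial's lemma: the closed convex sets \<open>D i\<close> replace the hypothesis that weak cluster
  points belong to \<open>S\<close>.\<close>

lemma fejer_weakly_converges:
  fixes y :: "nat \<Rightarrow> 'a::{real_inner, complete_space}"
  assumes bdd: "bounded (range y)"
    and fejer: "\<And>z. z \<in> S \<Longrightarrow> convergent (\<lambda>k. (norm (y k - z))\<^sup>2)"
    and D: "\<And>i. i \<in> I \<Longrightarrow> closed (D i)" "\<And>i. i \<in> I \<Longrightarrow> convex (D i)"
      "\<And>i. i \<in> I \<Longrightarrow> \<forall>\<^sub>F k in sequentially. y k \<in> D i"
    and S: "(\<Inter>i\<in>I. D i) \<subseteq> S"
  shows "\<exists>u\<in>S. weakly_converges y u"
proof -
  obtain u where u: "\<And>z. asym_radius y u + (norm (z - u))\<^sup>2 / 2 \<le> asym_radius y z"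
    and uD: "\<And>D. \<lbrakk>closed D; convex D; \<forall>\<^sub>F k in sequentially. y k \<in> D\<rbrakk> \<Longrightarrow> u \<in> D"
    using asymptotic_center[OF bdd] by metis
  have uS: "u \<in> S" using S uD D by blast
  \<comment> \<open>The center of such a subsequence would both equal \<open>u\<close> and lie in
    the separated half-space.\<close>
  have no_subseq: False
    if \<phi>: "bounded_linear \<phi>" and \<sigma>: "strict_mono \<sigma>" and e: "e > 0"
      and far: "\<And>n. \<phi> u + e \<le> \<phi> (y (\<sigma> n))" for \<phi> :: "'a \<Rightarrow> real" and \<sigma> :: "nat \<Rightarrow> nat" and e
  proof -
    interpret bounded_linear \<phi> by (rule \<phi>)
    have bdd': "bounded (range (y \<circ> \<sigma>))" using bdd by (rule bounded_subset) auto
    obtain v where v: "\<And>z. asym_radius (y \<circ> \<sigma>) v + (norm (z - v))\<^sup>2 / 2 \<le> asym_radius (y \<circ> \<sigma>) z"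
      and vD: "\<And>D. \<lbrakk>closed D; convex D; \<forall>\<^sub>F k in sequentially. (y \<circ> \<sigma>) k \<in> D\<rbrakk> \<Longrightarrow> v \<in> D"
      using asymptotic_center[OF bdd'] by metis
    have "\<forall>\<^sub>F k in sequentially. (y \<circ> \<sigma>) k \<in> D i" if "i \<in> I" for i
      using eventually_subseq[OF \<sigma> D(3)[OF that]] by simp
    then have vS: "v \<in> S" using S vD D(1,2) by blast
    have same: "asym_radius (y \<circ> \<sigma>) z = asym_radius y z" if "z \<in> S" for z
    proof -
      obtain l where l: "(\<lambda>k. (norm (y k - z))\<^sup>2) \<longlonglongrightarrow> l"
        using fejer[OF \<open>z \<in> S\<close>] by (auto simp: convergent_def)
      have "(\<lambda>k. (norm ((y \<circ> \<sigma>) k - z))\<^sup>2) \<longlonglongrightarrow> l"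
        using LIMSEQ_subseq_LIMSEQ[OF l \<sigma>] by (simp add: o_def)
      then show ?thesis using asym_radius_eq_lim[OF bdd l] asym_radius_eq_lim[OF bdd'] by simp
    qed
    \<comment> \<open>Each center's growth inequality is taken at the other center. The two radii
      agree on \<open>S\<close>, so they cancel in the sum.\<close>
    have "(norm (u - v))\<^sup>2 \<le> 0"
      using v[of u] u[of v] same[OF uS] same[OF vS] zero_le_power2[of "norm (v - u)"] by linarith
    then have "u = v" by simp
    moreover have "v \<in> {z. \<phi> u + e \<le> \<phi> z}"
    proof (rule vD)
      show "closed {z. \<phi> u + e \<le> \<phi> z}"
        by (intro closed_Collect_le continuous_intros linear_continuous_on \<phi>)
      have "{z. \<phi> u + e \<le> \<phi> z} = \<phi> -` {\<phi> u + e..}" by auto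
      then show "convex {z. \<phi> u + e \<le> \<phi> z}"
        using convex_linear_vimage[OF linear, of "{\<phi> u + e..}"] by simp
    qed (use far in simp)
    ultimately show False using e by simp
  qed
  \<comment> \<open>An upper bound suffices: applied to the negated functional it gives the lower
    one.\<close>
  have upper: "\<forall>\<^sub>F k in sequentially. \<phi> (y k) < \<phi> u + e"
    if "bounded_linear \<phi>" "e > 0" for \<phi> :: "'a \<Rightarrow> real" and e
  proof (rule ccontr)
    assume "\<not> ?thesis"
    then have "\<forall>n. \<exists>k\<ge>n. \<phi> u + e \<le> \<phi> (y k)" by (auto simp: eventually_sequentially not_less)
    then have "infinite {k. \<phi> u + e \<le> \<phi> (y k)}" unfolding infinite_nat_iff_unbounded_le by simp
    then obtain \<sigma> :: "nat \<Rightarrow> nat" where "strict_mono \<sigma>" "\<And>n. \<sigma> n \<in> {k. \<phi> u + e \<le> \<phi> (y k)}"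
      using infinite_enumerate by blast
    then show False using no_subseq[OF that(1) _ that(2), of \<sigma>] by simp
  qed
  have "weakly_converges y u"
    unfolding weakly_converges_def
  proof (intro allI impI LIMSEQ_I)
    fix \<phi> :: "'a \<Rightarrow> real" and e :: real
    assume \<phi>: "bounded_linear \<phi>" and e: "e > 0"
    have "\<forall>\<^sub>F k in sequentially. norm (\<phi> (y k) - \<phi> u) < e"
      using upper[OF \<phi> e] upper[OF bounded_linear_minus[OF \<phi>] e] by eventually_elim simp
    then show "\<exists>n0. \<forall>k\<ge>n0. norm (\<phi> (y k) - \<phi> u) < e" by (simp add: eventually_sequentially)
  qed
  then show ?thesis using uS by blast
qed

section \<open>The projected gradient method\<close>

text \<open>The difference quotients along \<open>\<theta> ^ j\<close> tend to minus the slope,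
  which is strictly below minus \<open>\<delta>\<close> times the slope, as the slope is positive
  and \<open>\<delta> < 1\<close>.\<close>

lemma armijo_search:
  assumes "has_gateaux_gradient f (grad f w) w" "0 < \<theta>" "\<theta> < 1" "\<delta> < 1"
    and pos: "0 < inner (grad f w) (w - proj_grad_point f C b w)"
  shows "\<exists>j. f (search_point f C \<theta> b w j)
    \<le> f w - \<delta> * \<theta> ^ j * inner (grad f w) (w - proj_grad_point f C b w)"
proof -
  define d where "d = w - proj_grad_point f C b w"
  have pt: "search_point f C \<theta> b w j = w + \<theta> ^ j *\<^sub>R (- d)" for j
    by (simp add: search_point_def d_def algebra_simps)
  have "filterlim (\<lambda>j. \<theta> ^ j) (at_right 0) sequentially"
    unfolding filterlim_at using assms(2,3) by (auto intro!: LIMSEQ_power_zero)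
  moreover have "((\<lambda>t. (f (w + t *\<^sub>R (- d)) - f w) / t) \<longlongrightarrow> inner (grad f w) (- d)) (at_right 0)"
    using assms(1) unfolding has_gateaux_gradient_def by blast
  ultimately have "(\<lambda>j. (f (w + \<theta> ^ j *\<^sub>R (- d)) - f w) / \<theta> ^ j) \<longlonglongrightarrow> inner (grad f w) (- d)"
    by (rule filterlim_compose[rotated])
  moreover have "inner (grad f w) (- d) < - (\<delta> * inner (grad f w) d)"
    using mult_strict_right_mono[OF assms(4) pos] by (simp add: d_def inner_diff_right)
  ultimately have "\<forall>\<^sub>F j in sequentially. (f (w + \<theta> ^ j *\<^sub>R (- d)) - f w) / \<theta> ^ j < - (\<delta> * inner (grad f w) d)"
    by (rule order_tendstoD)
  then obtain j where "(f (w + \<theta> ^ j *\<^sub>R (- d)) - f w) / \<theta> ^ j < - (\<delta> * inner (grad f w) d)"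
    by (auto simp: eventually_sequentially)
  then have "f (search_point f C \<theta> b w j) \<le> f w - \<delta> * \<theta> ^ j * inner (grad f w) d"
    unfolding pt using assms(2) by (simp add: field_simps)
  then show ?thesis unfolding d_def by blast
qed

locale projected_gradient =
  fixes f :: "'h::{real_inner, complete_space} \<Rightarrow> real"
    and C :: "'h set"
    and \<theta> \<delta> \<beta>_lo \<beta>_hi :: real
    and \<beta> :: "nat \<Rightarrow> real"
    and x :: "nat \<Rightarrow> 'h"
  assumes C: "closed C" "convex C" "C \<noteq> {}"
    and convex: "convex_on UNIV f"
    and differentiable: "\<And>y. gateaux_differentiable_at f y"
    and unif_cont: "\<And>B. bounded B \<Longrightarrow> uniformly_continuous_on B (grad f)"
    and \<theta>: "0 < \<theta>" "\<theta> < 1"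
    and \<delta>: "0 < \<delta>" "\<delta> < 1"
    and \<beta>_lo: "0 < \<beta>_lo"
    and \<beta>: "\<And>k. \<beta>_lo \<le> \<beta> k" "\<And>k. \<beta> k \<le> \<beta>_hi"
    and gen: "generated_by_A1 f C \<theta> \<delta> \<beta> x"
begin

section \<open>Basic inequalities for one iteration\<close>

definition p :: "nat \<Rightarrow> 'h" where "p k = proj_grad_point f C (\<beta> k) (x k)"
definition d :: "nat \<Rightarrow> 'h" where "d k = x k - p k"
text \<open>Minus the derivative of \<open>f\<close> at \<open>x k\<close> in the direction
  \<open>p k - x k\<close>.\<close>

definition slope :: "nat \<Rightarrow> real" where "slope k = inner (grad f (x k)) (d k)"
definition \<alpha> :: "nat \<Rightarrow> real" where "\<alpha> k = \<theta> ^ search_index f C \<theta> \<delta> (\<beta> k) (x k)"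

lemma \<beta>_pos: "0 < \<beta> k"
  using \<beta>(1)[of k] \<beta>_lo by simp

lemma \<alpha>_bounds: "0 < \<alpha> k" "\<alpha> k \<le> 1"
  using \<theta> by (simp_all add: \<alpha>_def power_le_one)

lemma gradient_ineq: "f w + inner (grad f w) (y - w) \<le> f y"
  by (rule convex_gradient_ineq[OF convex has_gateaux_gradient_grad[OF differentiable]])

lemma p_in: "p k \<in> C"
  unfolding p_def proj_grad_point_def by (rule metric_proj_in[OF C])

text \<open>The variational inequality of the projection: the projected point minus
  \<open>p k\<close> is \<open>d k - \<beta> k *\<^sub>R grad f (x k)\<close>.\<close>

lemma p_dot:
  assumes "y \<in> C"
  shows "inner (d k - \<beta> k *\<^sub>R grad f (x k)) (y - p k) \<le> 0"
  using metric_proj_dot[OF C assms, of "x k - \<beta> k *\<^sub>R grad f (x k)"]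
  by (simp add: d_def p_def proj_grad_point_def algebra_simps)

lemma step: "x (Suc k) = x k - \<alpha> k *\<^sub>R d k"
  using gen unfolding generated_by_A1_def Let_def
  by (simp add: \<alpha>_def d_def p_def algebra_simps)

lemma d_nonzero: "d k \<noteq> 0"
  using gen unfolding generated_by_A1_def by (simp add: d_def p_def)

lemma x_in: "x k \<in> C"
proof (induction k)
  case 0
  then show ?case using gen by (simp add: generated_by_A1_def)
next
  case (Suc k)
  have "x (Suc k) = (1 - \<alpha> k) *\<^sub>R x k + \<alpha> k *\<^sub>R p k" by (simp add: step d_def algebra_simps)
  then show ?case using convexD_alt[OF C(2) Suc p_in, of "\<alpha> k"] \<alpha>_bounds[of k] by simp
qed

text \<open>The case \<open>y = x k\<close> of \<open>p_dot\<close>. It makes \<open>- d k\<close> a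
  descent direction while the algorithm has not stopped.\<close>

lemma norm_d_le_slope: "(norm (d k))\<^sup>2 \<le> \<beta> k * slope k"
  using p_dot[OF x_in, of k k] by (simp add: d_def[symmetric] slope_def inner_diff_left power2_norm_eq_inner)

lemma slope_pos: "0 < slope k"
proof -
  have "0 < \<beta> k * slope k" using norm_d_le_slope[of k] d_nonzero[of k] by (smt (verit) zero_less_norm_iff zero_less_power)
  then show ?thesis using \<beta>_pos[of k] by (simp add: zero_less_mult_iff)
qed

text \<open>The gradient inequality at \<open>x k\<close> combined with \<open>p_dot\<close> at
  \<open>z\<close>; the \<open>slope\<close> term is the cost of replacing \<open>p k\<close> by
  \<open>x k\<close> in the gradient product.\<close>

lemma gap_le:
  assumes "z \<in> C"
  shows "\<beta> k * (f (x k) - f z) - \<beta> k * slope k \<le> inner (d k) (p k - z)"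
proof -
  have "\<beta> k * (f (x k) - f z) \<le> \<beta> k * inner (grad f (x k)) (x k - z)"
    using gradient_ineq[of "x k" z] \<beta>_pos[of k] by (simp add: inner_diff_right)
  moreover have "inner (d k) (p k - z) \<ge> \<beta> k * inner (grad f (x k)) (p k - z)"
    using p_dot[OF assms, of k] by (simp add: inner_diff_left inner_diff_right algebra_simps)
  moreover have "\<beta> k * inner (grad f (x k)) (p k - z) = \<beta> k * inner (grad f (x k)) (x k - z) - \<beta> k * slope k"
    by (simp add: slope_def d_def inner_diff_right algebra_simps)
  ultimately show ?thesis by simp
qed

section \<open>The line search\<close>

lemma search_point_eq: "search_point f C \<theta> (\<beta> k) (x k) j = x k - \<theta> ^ j *\<^sub>R d k"
  by (simp add: search_point_def d_def p_def algebra_simps)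

lemma search_index_eq:
  "search_index f C \<theta> \<delta> (\<beta> k) (x k) = (LEAST j. f (x k - \<theta> ^ j *\<^sub>R d k) \<le> f (x k) - \<delta> * \<theta> ^ j * slope k)"
  unfolding search_index_def search_point_eq by (simp add: slope_def d_def p_def)

lemma descent: "f (x (Suc k)) \<le> f (x k) - \<delta> * \<alpha> k * slope k"
proof -
  have "\<exists>j. f (x k - \<theta> ^ j *\<^sub>R d k) \<le> f (x k) - \<delta> * \<theta> ^ j * slope k"
    using armijo_search[OF has_gateaux_gradient_grad[OF differentiable] \<theta> \<delta>(2), of "x k" C "\<beta> k"]
      slope_pos[of k] unfolding search_point_eq by (simp add: slope_def d_def p_def)
  from LeastI_ex[OF this] show ?thesis unfolding step \<alpha>_def search_index_eq by simp
qed

text \<open>By minimality of the search index the preceding trial step, longer by the factor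
  \<open>1 / \<theta>\<close>, was rejected; \<open>\<alpha> k < 1\<close> ensures that there was
  one.\<close>

lemma backtrack:
  assumes "\<alpha> k < 1"
  shows "f (x k) - \<delta> * (\<alpha> k / \<theta>) * slope k < f (x k - (\<alpha> k / \<theta>) *\<^sub>R d k)"
proof -
  let ?n = "search_index f C \<theta> \<delta> (\<beta> k) (x k)"
  have "?n \<noteq> 0" using assms by (metis \<alpha>_def less_irrefl power_0)
  then obtain j where j: "?n = Suc j" using not0_implies_Suc by blast
  have \<alpha>: "\<alpha> k / \<theta> = \<theta> ^ j" using j \<theta> by (simp add: \<alpha>_def)
  have "j < (LEAST j. f (x k - \<theta> ^ j *\<^sub>R d k) \<le> f (x k) - \<delta> * \<theta> ^ j * slope k)"
    using j by (simp add: search_index_eq)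
  from not_less_Least[OF this]
  show "f (x k) - \<delta> * (\<alpha> k / \<theta>) * slope k < f (x k - (\<alpha> k / \<theta>) *\<^sub>R d k)"
    unfolding \<alpha> by simp
qed

text \<open>The defect of Fejer monotonicity is at most the decrease of \<open>f\<close>, which telescopes.\<close>

lemma quasi_fejer:
  assumes "z \<in> C"
  shows "(norm (x (Suc k) - z))\<^sup>2 + 2 * \<beta>_hi / \<delta> * f (x (Suc k)) + 2 * \<alpha> k * \<beta> k * (f (x k) - f z)
    \<le> (norm (x k - z))\<^sup>2 + 2 * \<beta>_hi / \<delta> * f (x k)"
proof -
  \<comment> \<open>The factor \<open>\<beta>_hi / \<delta>\<close> trades the slope term for the
    decrease of \<open>f\<close> that the line search guarantees.\<close>
  have "\<alpha> k * \<beta> k * slope k \<le> \<beta>_hi / \<delta> * (\<delta> * \<alpha> k * slope k)"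
    using \<beta>(2)[of k] \<alpha>_bounds[of k] slope_pos[of k] \<delta>
    by (simp add: mult.commute mult.left_commute mult_left_mono)
  also have "\<dots> \<le> \<beta>_hi / \<delta> * (f (x k) - f (x (Suc k)))"
    using descent[of k] \<beta>(2)[of k] \<beta>_pos[of k] \<delta> by (intro mult_left_mono) auto
  finally have slope: "\<alpha> k * \<beta> k * slope k \<le> \<beta>_hi / \<delta> * (f (x k) - f (x (Suc k)))" .
  have "inner (d k) (x k - z) = (norm (d k))\<^sup>2 + inner (d k) (p k - z)"
    by (simp add: d_def power2_norm_eq_inner inner_simps)
  then have "\<alpha> k * inner (d k) (x k - z) \<ge> \<alpha> k * ((norm (d k))\<^sup>2 + (\<beta> k * (f (x k) - f z) - \<beta> k * slope k))"
    using gap_le[OF assms, of k] \<alpha>_bounds[of k] by (intro mult_left_mono) auto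
  then have inner: "\<alpha> k * inner (d k) (x k - z) \<ge> \<alpha> k * (norm (d k))\<^sup>2 + \<alpha> k * \<beta> k * (f (x k) - f z) - \<alpha> k * \<beta> k * slope k"
    by (simp add: algebra_simps)
  have "(norm (x (Suc k) - z))\<^sup>2 = (norm (x k - z))\<^sup>2 - 2 * (\<alpha> k * inner (d k) (x k - z)) + (\<alpha> k)\<^sup>2 * (norm (d k))\<^sup>2"
    unfolding step power2_norm_eq_inner
    by (simp add: inner_simps inner_commute power2_eq_square algebra_simps)
  \<comment> \<open>Since \<open>\<alpha> k \<le> 1\<close>, the quadratic term of the expansion is
    absorbed by the \<open>(norm (d k))\<^sup>2\<close> part of the linear term.\<close>
  moreover have "(\<alpha> k)\<^sup>2 * (norm (d k))\<^sup>2 \<le> \<alpha> k * (norm (d k))\<^sup>2"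
    using \<alpha>_bounds[of k] by (intro mult_right_mono) (auto simp: power2_eq_square mult_left_le)
  moreover have "0 \<le> \<alpha> k * (norm (d k))\<^sup>2" using \<alpha>_bounds[of k] by simp
  ultimately have "(norm (x (Suc k) - z))\<^sup>2 + 2 * (\<alpha> k * \<beta> k * (f (x k) - f z))
    \<le> (norm (x k - z))\<^sup>2 + 2 * (\<beta>_hi / \<delta> * (f (x k) - f (x (Suc k))))"
    using inner slope by linarith
  then show ?thesis by (simp add: algebra_simps)
qed

section \<open>Convergence of values and distances\<close>

lemma decseq_f: "decseq (\<lambda>k. f (x k))"
proof (rule decseq_SucI)
  fix k
  have "0 \<le> \<delta> * \<alpha> k * slope k" using \<delta> \<alpha>_bounds[of k] slope_pos[of k] by simp
  then show "f (x (Suc k)) \<le> f (x k)" using descent[of k] by simp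
qed

text \<open>Gaps to a solution are nonnegative, so \<open>quasi_fejer\<close> makes the sum
  decreasing; a multiple of \<open>f z\<close> bounds it below.\<close>

lemma lyapunov_convergent:
  assumes z: "z \<in> solution_set f C"
  shows "convergent (\<lambda>k. (norm (x k - z))\<^sup>2 + 2 * \<beta>_hi / \<delta> * f (x k))"
proof -
  have zC: "z \<in> C" and fz: "f z \<le> f (x k)" for k
    using z x_in by (auto simp: solution_set_def)
  have hi: "0 \<le> 2 * \<beta>_hi / \<delta>" using \<beta>(2)[of 0] \<beta>_pos[of 0] \<delta> by simp
  have "0 \<le> 2 * \<alpha> k * \<beta> k * (f (x k) - f z)" for k
    using \<alpha>_bounds[of k] \<beta>_pos[of k] fz[of k] by simp
  then have "decseq (\<lambda>k. (norm (x k - z))\<^sup>2 + 2 * \<beta>_hi / \<delta> * f (x k))"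
    by (intro decseq_SucI) (smt (verit) quasi_fejer[OF zC])
  moreover have "2 * \<beta>_hi / \<delta> * f z \<le> (norm (x k - z))\<^sup>2 + 2 * \<beta>_hi / \<delta> * f (x k)" for k
    using mult_left_mono[OF fz[of k] hi] by (smt (verit) zero_le_power2)
  ultimately show ?thesis using decseq_convergent convergentI by blast
qed

lemma distance_convergent:
  assumes z: "z \<in> solution_set f C"
  shows "convergent (\<lambda>k. (norm (x k - z))\<^sup>2)"
proof -
  have "f z \<le> f (x k)" for k using z x_in by (auto simp: solution_set_def)
  then have "convergent (\<lambda>k. f (x k))"
    using decseq_convergent[OF decseq_f] convergentI by blast
  then have "convergent (\<lambda>k. 2 * \<beta>_hi / \<delta> * f (x k))" by (rule convergent_mult[OF convergent_const])
  from convergent_diff[OF lyapunov_convergent[OF z] this] show ?thesis by simp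
qed

lemma bounded_x:
  assumes z: "z \<in> solution_set f C"
  shows "bounded (range x)"
proof -
  obtain B where B: "\<And>k. norm ((norm (x k - z))\<^sup>2) \<le> B"
    using convergent_imp_Bseq[OF distance_convergent[OF z]] unfolding Bseq_def by blast
  have "norm (x k) \<le> norm z + sqrt B" for k
    using norm_triangle_sub[of "x k" z] real_le_rsqrt[of "norm (x k - z)" B] B[of k] by simp
  then show ?thesis by (auto intro!: boundedI)
qed

lemma f_tendsto_min:
  assumes z: "z \<in> solution_set f C"
  shows "(\<lambda>k. f (x k)) \<longlonglongrightarrow> f z"
proof (rule ccontr)
  assume contra: "\<not> ?thesis"
  have zC: "z \<in> C" and fz: "\<And>k. f z \<le> f (x k)"
    using z x_in by (auto simp: solution_set_def)
  obtain L where L: "(\<lambda>k. f (x k)) \<longlonglongrightarrow> L" "\<And>k. L \<le> f (x k)"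
    using decseq_convergent[OF decseq_f] fz by metis
  \<comment> \<open>The values decrease to \<open>L\<close>, so this gap persists at every
    iterate.\<close>
  define \<epsilon> where "\<epsilon> = L - f z"
  have "f z \<le> L" by (rule LIMSEQ_le_const[OF L(1)]) (use fz in auto)
  with contra L(1) have \<epsilon>: "\<epsilon> > 0" by (auto simp: \<epsilon>_def order_less_le)
  have gap: "\<epsilon> \<le> f (x k) - f z" for k using L(2)[of k] by (simp add: \<epsilon>_def)
  define V where "V k = (norm (x k - z))\<^sup>2 + 2 * \<beta>_hi / \<delta> * f (x k)" for k
  \<comment> \<open>By \<open>quasi_fejer\<close> the gap costs \<open>V\<close> at least
    \<open>2 * \<beta>_lo * \<epsilon> * \<alpha> k\<close> per step, while the decrements of the
    convergent \<open>V\<close> vanish.\<close>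
  have \<alpha>_lim: "\<alpha> \<longlonglongrightarrow> 0"
  proof (rule tendsto_sandwich)
    show "\<forall>\<^sub>F k in sequentially. 0 \<le> \<alpha> k"
      using \<alpha>_bounds(1) by (intro always_eventually allI less_imp_le)
    show "\<forall>\<^sub>F k in sequentially. \<alpha> k \<le> (V k - V (Suc k)) / (2 * \<beta>_lo * \<epsilon>)"
    proof (intro always_eventually allI)
      fix k
      have "\<alpha> k * (2 * (\<beta>_lo * \<epsilon>)) \<le> \<alpha> k * (2 * (\<beta> k * (f (x k) - f z)))"
        using \<alpha>_bounds[of k] \<beta>(1)[of k] \<beta>_lo \<epsilon> gap[of k] by (intro mult_left_mono mult_mono) auto
      also have "\<dots> \<le> V k - V (Suc k)"
        using quasi_fejer[OF zC, of k] by (simp add: V_def algebra_simps)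
      finally show "\<alpha> k \<le> (V k - V (Suc k)) / (2 * \<beta>_lo * \<epsilon>)"
        using \<beta>_lo \<epsilon> by (simp add: pos_le_divide_eq mult.assoc)
    qed
    obtain l where l: "V \<longlonglongrightarrow> l"
      using lyapunov_convergent[OF z] unfolding V_def convergent_def by blast
    have "(\<lambda>k. (V k - V (Suc k)) / (2 * \<beta>_lo * \<epsilon>)) \<longlonglongrightarrow> (l - l) / (2 * \<beta>_lo * \<epsilon>)"
      by (intro tendsto_intros l LIMSEQ_Suc) (use \<beta>_lo \<epsilon> in auto)
    then show "(\<lambda>k. (V k - V (Suc k)) / (2 * \<beta>_lo * \<epsilon>)) \<longlonglongrightarrow> 0" by simp
  qed (rule tendsto_const)
  obtain M where M: "\<And>k. norm (x k) \<le> M" using bounded_x[OF z] by (auto simp: bounded_iff)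
  have "bounded (grad f ` cball 0 M)"
    by (rule bounded_uniformly_continuous_ball_image[OF unif_cont[OF bounded_cball]])
  then obtain G where G: "\<And>w. norm w \<le> M \<Longrightarrow> norm (grad f w) \<le> G"
    unfolding bounded_iff by (metis image_eqI mem_cball_0)
  \<comment> \<open>Cauchy-Schwarz in \<open>norm_d_le_slope\<close>, then division by the nonzero
    \<open>norm (d k)\<close>.\<close>
  have d_le: "norm (d k) \<le> \<beta>_hi * G" for k
  proof -
    have "(norm (d k))\<^sup>2 \<le> \<beta> k * (norm (grad f (x k)) * norm (d k))"
      using norm_d_le_slope[of k] norm_cauchy_schwarz[of "grad f (x k)" "d k"] \<beta>_pos[of k]
      unfolding slope_def by (meson less_imp_le mult_left_mono order_trans)
    also have "\<dots> \<le> \<beta>_hi * (G * norm (d k))"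
      using \<beta>(2)[of k] \<beta>_pos[of k] G[OF M, of k] order_trans[OF norm_ge_zero G[OF M, of k]]
      by (intro mult_mono mult_right_mono mult_nonneg_nonneg) auto
    finally show ?thesis using d_nonzero[of k] by (simp add: power2_eq_square)
  qed
  \<comment> \<open>The last rejected trial point, once \<open>\<alpha> k < 1\<close>.\<close>
  define y where "y k = x k - (\<alpha> k / \<theta>) *\<^sub>R d k" for k
  have small: "\<forall>\<^sub>F k in sequentially. \<alpha> k < 1" by (rule order_tendstoD[OF \<alpha>_lim]) simp
  have d_lim0: "(\<lambda>k. (\<alpha> k / \<theta>) *\<^sub>R d k) \<longlonglongrightarrow> 0"
  proof (rule Lim_null_comparison)
    show "\<forall>\<^sub>F k in sequentially. norm ((\<alpha> k / \<theta>) *\<^sub>R d k) \<le> \<alpha> k / \<theta> * (\<beta>_hi * G)"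
    proof (intro always_eventually allI)
      fix k
      show "norm ((\<alpha> k / \<theta>) *\<^sub>R d k) \<le> \<alpha> k / \<theta> * (\<beta>_hi * G)"
        using mult_left_mono[OF d_le[of k], of "\<alpha> k / \<theta>"] \<alpha>_bounds(1)[of k] \<theta> by simp
    qed
    show "(\<lambda>k. \<alpha> k / \<theta> * (\<beta>_hi * G)) \<longlonglongrightarrow> 0"
      using tendsto_mult_left_zero[OF tendsto_divide_zero[OF \<alpha>_lim]] by simp
  qed
  obtain M' where "\<And>k. norm ((\<alpha> k / \<theta>) *\<^sub>R d k) \<le> M'"
    using convergent_imp_Bseq[OF convergentI[OF d_lim0]] unfolding Bseq_def by blast
  then have "norm (y k) \<le> M + M'" for k
    using norm_triangle_ineq4[of "x k" "(\<alpha> k / \<theta>) *\<^sub>R d k"] M[of k] unfolding y_def by (smt (verit))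
  \<comment> \<open>Uniform continuity can compare the gradients only if both sequences lie in one
    bounded set.\<close>
  then have bdd: "bounded (range x \<union> range y)" using bounded_x[OF z] by (auto intro!: boundedI)
  have "(\<lambda>k. dist (x k) (y k)) \<longlonglongrightarrow> 0"
    using tendsto_norm_zero[OF d_lim0] by (simp add: y_def dist_norm del: norm_scaleR)
  with unif_cont[OF bdd] have "(\<lambda>k. dist (grad f (x k)) (grad f (y k))) \<longlonglongrightarrow> 0"
    unfolding uniformly_continuous_on_sequentially by simp
  then have diff_lim: "(\<lambda>k. dist (grad f (x k)) (grad f (y k)) * (\<beta>_hi * G) / (1 - \<delta>)) \<longlonglongrightarrow> 0"
    by (intro tendsto_divide_zero tendsto_mult_left_zero)
  have slope_lim: "slope \<longlonglongrightarrow> 0"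
  proof (rule tendsto_sandwich[OF _ _ tendsto_const diff_lim])
    show "\<forall>\<^sub>F k in sequentially. slope k \<le> dist (grad f (x k)) (grad f (y k)) * (\<beta>_hi * G) / (1 - \<delta>)"
      using small
    proof eventually_elim
      case (elim k)
      have s: "0 < \<alpha> k / \<theta>" using \<alpha>_bounds[of k] \<theta> by simp
      \<comment> \<open>The gradient inequality at \<open>y k\<close> and the rejection of
        \<open>y k\<close> enclose \<open>f (x k) - f (y k)\<close>. Hence between
        \<open>x k\<close> and \<open>y k\<close> the gradient's product with \<open>d k\<close>
        drops by at least the share \<open>1 - \<delta>\<close> of the slope.\<close>
      have "\<alpha> k / \<theta> * inner (grad f (y k)) (d k) \<le> f (x k) - f (y k)"
        using gradient_ineq[of "y k" "x k"] by (simp add: y_def)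
      also have "\<dots> < \<alpha> k / \<theta> * (\<delta> * slope k)"
        using backtrack[OF elim] by (simp add: y_def algebra_simps)
      finally have "inner (grad f (y k)) (d k) < \<delta> * slope k" using s
        by (simp only: mult_less_cancel_left_pos)
      then have "(1 - \<delta>) * slope k \<le> inner (grad f (x k) - grad f (y k)) (d k)"
        by (simp add: slope_def inner_diff_left algebra_simps)
      also have "\<dots> \<le> dist (grad f (x k)) (grad f (y k)) * norm (d k)"
        unfolding dist_norm by (rule norm_cauchy_schwarz)
      also have "\<dots> \<le> dist (grad f (x k)) (grad f (y k)) * (\<beta>_hi * G)"
        by (rule mult_left_mono[OF d_le]) simp
      finally show ?case using \<delta> by (simp add: pos_le_divide_eq mult.commute)
    qed
    show "\<forall>\<^sub>F k in sequentially. 0 \<le> slope k"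
      using slope_pos by (intro always_eventually allI less_imp_le)
  qed
  have \<beta>slope_lim: "(\<lambda>k. \<beta>_hi * slope k) \<longlonglongrightarrow> 0"
    using tendsto_mult_right_zero[OF slope_lim] .
  have \<beta>slope: "\<beta> k * slope k \<le> \<beta>_hi * slope k" for k
    using \<beta>(2)[of k] slope_pos[of k] by simp
  have "(\<lambda>k. (norm (d k))\<^sup>2) \<longlonglongrightarrow> 0"
  proof (rule tendsto_sandwich[OF _ _ tendsto_const \<beta>slope_lim])
    show "\<forall>\<^sub>F k in sequentially. (norm (d k))\<^sup>2 \<le> \<beta>_hi * slope k"
      by (intro always_eventually allI order_trans[OF norm_d_le_slope \<beta>slope])
  qed simp
  from tendsto_real_sqrt[OF this] have d_lim: "(\<lambda>k. norm (d k)) \<longlonglongrightarrow> 0" by simp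
  \<comment> \<open>The bracket bounds \<open>norm (p k - z)\<close>. The right side tends to 0,
    while the left is a positive constant.\<close>
  have "\<beta>_lo * \<epsilon> \<le> norm (d k) * (M + \<beta>_hi * G + norm z) + \<beta>_hi * slope k" for k
  proof -
    have "\<beta>_lo * \<epsilon> \<le> \<beta> k * (f (x k) - f z)"
      using \<beta>(1)[of k] \<beta>_pos[of k] gap[of k] \<epsilon> by (intro mult_mono) auto
    also have "\<dots> \<le> norm (d k) * norm (p k - z) + \<beta>_hi * slope k"
      using gap_le[OF zC, of k] norm_cauchy_schwarz[of "d k" "p k - z"] \<beta>slope[of k] by linarith
    also have "norm (d k) * norm (p k - z) \<le> norm (d k) * (M + \<beta>_hi * G + norm z)"
    proof (rule mult_left_mono)
      have "p k - z = x k - d k - z" by (simp add: d_def)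
      then show "norm (p k - z) \<le> M + \<beta>_hi * G + norm z"
        using norm_triangle_ineq4[of "x k - d k" z] norm_triangle_ineq4[of "x k" "d k"] M[of k] d_le[of k] by simp
    qed simp
    finally show ?thesis by simp
  qed
  moreover have "(\<lambda>k. norm (d k) * (M + \<beta>_hi * G + norm z) + \<beta>_hi * slope k) \<longlonglongrightarrow> 0"
    using tendsto_add[OF tendsto_mult_left_zero[OF d_lim] \<beta>slope_lim] by simp
  ultimately have "\<beta>_lo * \<epsilon> \<le> 0" by (intro LIMSEQ_le_const) auto
  then show False using \<beta>_lo \<epsilon> by (simp add: mult_le_0_iff)
qed

section \<open>Sublevel sets and the weak limit\<close>

text \<open>The supporting affine function at the limit \<open>l\<close> is continuous, lies below
  \<open>f\<close> and agrees with \<open>f\<close> at \<open>l\<close>, so the bound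
  \<open>c\<close> carries over from the sequence.\<close>

lemma closed_sublevel: "closed {w. f w \<le> c}"
  unfolding closed_sequential_limits
proof (intro allI impI, elim conjE)
  fix s :: "nat \<Rightarrow> 'h" and l
  assume s: "\<forall>n. s n \<in> {w. f w \<le> c}" "s \<longlonglongrightarrow> l"
  have "f l + inner (grad f l) (s n - l) \<le> c" for n
    using gradient_ineq[of l "s n"] s(1) by (auto intro: order_trans)
  moreover have "(\<lambda>n. f l + inner (grad f l) (s n - l)) \<longlonglongrightarrow> f l + inner (grad f l) (l - l)"
    by (intro tendsto_intros s(2))
  ultimately show "l \<in> {w. f w \<le> c}"
    using LIMSEQ_le_const2 by fastforce
qed

lemma convex_sublevel: "convex {w. f w \<le> c}"
proof (rule convexI)
  fix a b u v
  assume *: "a \<in> {w. f w \<le> c}" "b \<in> {w. f w \<le> c}" "0 \<le> u" "0 \<le> v" "u + v = (1::real)"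
  then have "f (u *\<^sub>R a + v *\<^sub>R b) \<le> u * f a + v * f b"
    using convex unfolding convex_on_def by blast
  also have "\<dots> \<le> c" using * by (intro convex_bound_le) auto
  finally show "u *\<^sub>R a + v *\<^sub>R b \<in> {w. f w \<le> c}" by simp
qed

text \<open>Since the values tend to the minimum, each near-optimal sublevel set within
  \<open>C\<close> contains a tail of \<open>x\<close>; these sets are closed and convex, and only
  solutions lie in all of them.\<close>

lemma weak_convergence:
  assumes z: "z \<in> solution_set f C"
  shows "\<exists>u\<in>solution_set f C. weakly_converges x u"
proof (rule fejer_weakly_converges[where I = "{e. 0 < e}" and D = "\<lambda>e. C \<inter> {w. f w \<le> f z + e}"])
  show "\<forall>\<^sub>F k in sequentially. x k \<in> C \<inter> {w. f w \<le> f z + e}" if "e \<in> {e. 0 < e}" for e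
  proof -
    have "\<forall>\<^sub>F k in sequentially. f (x k) < f z + e"
      using order_tendstoD(2)[OF f_tendsto_min[OF z]] that by simp
    then show ?thesis by eventually_elim (use x_in in auto)
  qed
  show "(\<Inter>e\<in>{e. 0 < e}. C \<inter> {w. f w \<le> f z + e}) \<subseteq> solution_set f C"
  proof
    fix w assume w: "w \<in> (\<Inter>e\<in>{e. 0 < e}. C \<inter> {w. f w \<le> f z + e})"
    have "(1::real) \<in> {e. 0 < e}" by simp
    with w have "w \<in> C" by blast
    moreover have "f w \<le> f z" by (rule field_le_epsilon) (use w in blast)
    ultimately show "w \<in> solution_set f C" using z by (auto simp: solution_set_def intro: order_trans)
  qed
qed (use C z in \<open>auto intro: bounded_x distance_convergent closed_Int convex_Int closed_sublevel convex_sublevel\<close>)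

end

theorem theorem3p2:
  fixes f :: "'h::{real_inner, complete_space} \<Rightarrow> real"
    and C :: "'h set"
    and \<theta> \<delta> \<beta>_lo \<beta>_hi :: real
    and \<beta> :: "nat \<Rightarrow> real"
    and x :: "nat \<Rightarrow> 'h"
  assumes "C \<noteq> {}" and "closed C" and "convex C"
    and "convex_on UNIV f"
    and "\<And>y. gateaux_differentiable_at f y"
    and "solution_set f C \<noteq> {}"
    and "\<And>B. bounded B \<Longrightarrow> uniformly_continuous_on B (grad f)"
    and "0 < \<theta>" and "\<theta> < 1"
    and "0 < \<delta>" and "\<delta> < 1"
    and "0 < \<beta>_lo" and "\<beta>_lo \<le> \<beta>_hi"
    and "\<And>k. \<beta>_lo \<le> \<beta> k \<and> \<beta> k \<le> \<beta>_hi"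
    and "generated_by_A1 f C \<theta> \<delta> \<beta> x"
  shows "\<exists>x_star \<in> solution_set f C. weakly_converges x x_star"
proof -
  interpret projected_gradient f C \<theta> \<delta> \<beta>_lo \<beta>_hi \<beta> x
    by unfold_locales (use assms in auto)
  show ?thesis using weak_convergence assms(6) by blast
qed

end
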